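(* Let $g:\mathbb{R}^m\to\mathbb{R}$ be a convex Fréchet differentiable function with $L_g$-Lipschitz continuous gradient, and assume that $\operatorname{argmin} g\neq\emptyset$. Let $t_0>0$, $u_0,v_0\in\mathbb{R}^m$, $\alpha>3$ and $\beta\ge 0$. Let $x:[t_0,+\infty)\to\mathbb{R}^m$ be the unique strong global solution of the dynamical system $$\ddot{x}(t)+\frac{\alpha}{t}\dot{x}(t)+\nabla g\left(x(t)+\frac{\beta}{t}\dot{x}(t)\right)=0,\qquad x(t_0)=u_0,\ \dot{x}(t_0)=v_0.$$ Then $x(t)$ converges to a point in $\operatorname{argmin} g$ as $t\to+\infty$.
   Context: $\mathbb{R}^m$ carries the Euclidean norm $\|\cdot\|$. That $\nabla g$ is $L_g$-Lipschitz means $L_g\ge 0$ and $\|\nabla g(x)-\nabla g(y)\|\le L_g\|x-y\|$ for all $x,y\in\mathbb{R}^m$. A function $x:[t_0,+\infty)\to\mathbb{R}^m$ is a strong global solution of the dynamical system if: (i) $x$ and $\dot x$ are locally absolutely continuous on $[t_0,+\infty)$ (i.e. absolutely continuous on every compact interval $[t_0,T]$, $T>t_0$); (ii) the differential equation holds for almost every $t\ge t_0$; (iii) $x(t_0)=u_0$ and $\dot x(t_0)=v_0$. Under the stated assumptions such a solution exists and is unique. *)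

theory Defs
  imports "HOL-Analysis.Analysis"
begin

text \<open>The usual epsilon-delta definition of absolute continuity on \<open>{a..b}\<close>. A finite family of
  non-overlapping compact subintervals \<open>{c..d}\<close> is a division \<open>D\<close> of its union; the endpoints of
  \<open>k \<in> D\<close> are \<open>Inf k\<close> and \<open>Sup k\<close>.\<close>

definition abs_continuous_on :: "real \<Rightarrow> real \<Rightarrow> (real \<Rightarrow> 'a::real_normed_vector) \<Rightarrow> bool" where
  "abs_continuous_on a b f \<longleftrightarrow>
     (\<forall>\<epsilon>>0. \<exists>\<delta>>0. \<forall>D. D division_of \<Union>D \<and> \<Union>D \<subseteq> {a..b} \<and> (\<Sum>k\<in>D. Sup k - Inf k) < \<delta>
        \<longrightarrow> (\<Sum>k\<in>D. norm (f (Sup k) - f (Inf k))) < \<epsilon>)"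

definition loc_abs_continuous_from :: "real \<Rightarrow> (real \<Rightarrow> 'a::real_normed_vector) \<Rightarrow> bool" where
  "loc_abs_continuous_from t0 f \<longleftrightarrow> (\<forall>T>t0. abs_continuous_on t0 T f)"

definition argmin_set :: "('a \<Rightarrow> real) \<Rightarrow> 'a set" where
  "argmin_set g = {z. is_arg_min g (\<lambda>_. True) z}"

text \<open>Trajectories on \<open>[t0, \<infinity>)\<close> are total functions on \<open>real\<close>; only their values on \<open>{t0..}\<close>
  matter, since all derivatives are taken within \<open>{t0..}\<close> (one-sided at \<open>t0\<close>). As the
  velocity \<open>x'\<close> is required to be absolutely continuous, hence defined and continuous on all of
  \<open>{t0..}\<close>, it is the derivative of \<open>x\<close> at every \<open>t \<ge> t0\<close>, whereas the acceleration \<open>x''\<close>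
  exists only almost everywhere.\<close>

definition strong_global_solution ::
  "('a::euclidean_space \<Rightarrow> 'a) \<Rightarrow> real \<Rightarrow> real \<Rightarrow> real \<Rightarrow> 'a \<Rightarrow> 'a \<Rightarrow> (real \<Rightarrow> 'a) \<Rightarrow> bool" where
  "strong_global_solution grad \<alpha> \<beta> t0 u0 v0 x \<longleftrightarrow>
     (\<exists>x'. (\<forall>t\<ge>t0. (x has_vector_derivative x' t) (at t within {t0..}))
         \<and> loc_abs_continuous_from t0 x
         \<and> loc_abs_continuous_from t0 x'
         \<and> (AE t in lebesgue. t \<ge> t0 \<longrightarrow>
              (\<exists>x''. (x' has_vector_derivative x'') (at t within {t0..})
                 \<and> x'' + (\<alpha> / t) *\<^sub>R x' t + grad (x t + (\<beta> / t) *\<^sub>R x' t) = 0))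
         \<and> x t0 = u0 \<and> x' t0 = v0)"

end

(* Since v = x' is absolutely continuous and the right-hand side of the equation is continuous in t,
   the equation holds for every t > t0.  With y = x + (beta/t) v and p a minimiser, the energies
     E_b(t) = t^2 (g(y) - g(p)) + |b (x - p) + t v|^2 / 2 + b (alpha - 1 - b) |x - p|^2 / 2
   are eventually nonincreasing for every 2 <= b < alpha - 1, so they converge.  Their boundedness gives
   g(y) -> min g and y - x -> 0.  The difference of two of them is a multiple of
   (alpha - 1) h + t h' with h = |x - p|^2 / 2, so h converges, and Opial's argument applies. *)

theory Submission
  imports Defs
begin

section \<open>Absolutely continuous functions of a real variable\<close>

lemma abs_continuous_on_diff:
  assumes f: "abs_continuous_on a b f" and g: "abs_continuous_on a b g"
  shows "abs_continuous_on a b (\<lambda>t. f t - g t)"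
  unfolding abs_continuous_on_def
proof (intro allI impI)
  fix \<epsilon> :: real
  assume "\<epsilon> > 0"
  then have "\<epsilon>/2 > 0" by simp
  obtain d1 where d1: "d1 > 0" "\<And>D. \<lbrakk>D division_of \<Union>D; \<Union>D \<subseteq> {a..b}; (\<Sum>k\<in>D. Sup k - Inf k) < d1\<rbrakk>
      \<Longrightarrow> (\<Sum>k\<in>D. norm (f (Sup k) - f (Inf k))) < \<epsilon>/2"
    using f \<open>\<epsilon>/2 > 0\<close> unfolding abs_continuous_on_def by meson
  obtain d2 where d2: "d2 > 0" "\<And>D. \<lbrakk>D division_of \<Union>D; \<Union>D \<subseteq> {a..b}; (\<Sum>k\<in>D. Sup k - Inf k) < d2\<rbrakk>
      \<Longrightarrow> (\<Sum>k\<in>D. norm (g (Sup k) - g (Inf k))) < \<epsilon>/2"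
    using g \<open>\<epsilon>/2 > 0\<close> unfolding abs_continuous_on_def by meson
  show "\<exists>\<delta>>0. \<forall>D. D division_of \<Union>D \<and> \<Union>D \<subseteq> {a..b} \<and> (\<Sum>k\<in>D. Sup k - Inf k) < \<delta>
        \<longrightarrow> (\<Sum>k\<in>D. norm (f (Sup k) - g (Sup k) - (f (Inf k) - g (Inf k)))) < \<epsilon>"
  proof (intro exI[of _ "min d1 d2"] conjI allI impI)
    fix D assume D: "D division_of \<Union>D \<and> \<Union>D \<subseteq> {a..b} \<and> (\<Sum>k\<in>D. Sup k - Inf k) < min d1 d2"
    have "(\<Sum>k\<in>D. norm (f (Sup k) - g (Sup k) - (f (Inf k) - g (Inf k))))
        \<le> (\<Sum>k\<in>D. norm (f (Sup k) - f (Inf k)) + norm (g (Sup k) - g (Inf k)))"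
    proof (rule sum_mono)
      fix k
      have "f (Sup k) - g (Sup k) - (f (Inf k) - g (Inf k)) = (f (Sup k) - f (Inf k)) - (g (Sup k) - g (Inf k))"
        by simp
      then show "norm (f (Sup k) - g (Sup k) - (f (Inf k) - g (Inf k)))
          \<le> norm (f (Sup k) - f (Inf k)) + norm (g (Sup k) - g (Inf k))"
        by (metis norm_triangle_ineq4)
    qed
    also have "\<dots> < \<epsilon>/2 + \<epsilon>/2"
      unfolding sum.distrib using D by (intro add_strict_mono d1(2) d2(2)) auto
    finally show "(\<Sum>k\<in>D. norm (f (Sup k) - g (Sup k) - (f (Inf k) - g (Inf k)))) < \<epsilon>" by simp
  qed (use d1 d2 in auto)
qed

lemma lipschitz_on_imp_abs_continuous_on:
  fixes f :: "real \<Rightarrow> 'a::real_normed_vector"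
  assumes "C-lipschitz_on {a..b} f"
  shows "abs_continuous_on a b f"
  unfolding abs_continuous_on_def
proof (intro allI impI)
  fix \<epsilon> :: real
  assume "\<epsilon> > 0"
  have C: "C \<ge> 0" using assms lipschitz_on_nonneg by blast
  show "\<exists>\<delta>>0. \<forall>D. D division_of \<Union>D \<and> \<Union>D \<subseteq> {a..b} \<and> (\<Sum>k\<in>D. Sup k - Inf k) < \<delta>
        \<longrightarrow> (\<Sum>k\<in>D. norm (f (Sup k) - f (Inf k))) < \<epsilon>"
  \<comment> \<open>The constant \<open>C + 1\<close> instead of \<open>C\<close> keeps the quotient
    meaningful when \<open>C = 0\<close>.\<close>
  proof (intro exI[of _ "\<epsilon> / (C + 1)"] conjI allI impI)
    show "\<epsilon> / (C + 1) > 0" using C \<open>\<epsilon> > 0\<close> by simp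
    fix D assume D: "D division_of \<Union>D \<and> \<Union>D \<subseteq> {a..b} \<and> (\<Sum>k\<in>D. Sup k - Inf k) < \<epsilon> / (C + 1)"
    have *: "Inf k \<in> {a..b} \<and> Sup k \<in> {a..b} \<and> Inf k \<le> Sup k" if "k \<in> D" for k
    proof -
      have div: "D division_of \<Union>D" using D by blast
      from division_ofD(4)[OF div that] obtain u v where k: "k = cbox u v" by blast
      with division_ofD(3)[OF div that] have "u \<le> v" by auto
      moreover have "k \<subseteq> {a..b}" using D that by blast
      ultimately show ?thesis using k by auto
    qed
    have "(\<Sum>k\<in>D. norm (f (Sup k) - f (Inf k))) \<le> (\<Sum>k\<in>D. (C + 1) * (Sup k - Inf k))"
    proof (rule sum_mono)
      fix k assume k: "k \<in> D"
      have "norm (f (Sup k) - f (Inf k)) \<le> C * (Sup k - Inf k)"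
        using lipschitz_onD[OF assms, of "Sup k" "Inf k"] *[OF k] by (simp add: dist_norm)
      also have "\<dots> \<le> (C + 1) * (Sup k - Inf k)" using *[OF k] by (intro mult_right_mono) auto
      finally show "norm (f (Sup k) - f (Inf k)) \<le> (C + 1) * (Sup k - Inf k)" .
    qed
    also have "\<dots> < \<epsilon>"
      using D C by (simp add: pos_less_divide_eq mult.commute flip: sum_distrib_left)
    finally show "(\<Sum>k\<in>D. norm (f (Sup k) - f (Inf k))) < \<epsilon>" .
  qed
qed

text \<open>Applied to a difference, this recovers a function from its derivative known off a null
  set. Mere continuity would not suffice, as the Cantor function shows.\<close>

lemma abs_continuous_on_zero_derivative_imp_eq:
  fixes f :: "real \<Rightarrow> 'a::real_normed_vector"
  assumes ac: "abs_continuous_on a b f" and "a \<le> b" and E: "negligible E"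
    and f': "\<And>t. t \<in> {a..b} - E \<Longrightarrow> (f has_vector_derivative 0) (at t within {a..b})"
  shows "f b = f a"
proof -
  \<comment> \<open>In a fine tagged division, the intervals tagged in \<open>E\<close> lie in an open set of measure less
    than \<open>\<delta>\<close>, and \<open>f\<close> varies by at most \<open>\<epsilon>\<close> times the length on the others.\<close>
  have "norm (f b - f a) \<le> \<epsilon> * (1 + (b - a))" if "\<epsilon> > 0" for \<epsilon> :: real
  proof -
    obtain \<delta> where \<delta>: "\<delta> > 0" "\<And>D. \<lbrakk>D division_of \<Union>D; \<Union>D \<subseteq> {a..b}; (\<Sum>k\<in>D. Sup k - Inf k) < \<delta>\<rbrakk>
      \<Longrightarrow> (\<Sum>k\<in>D. norm (f (Sup k) - f (Inf k))) < \<epsilon>"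
      using ac \<open>\<epsilon> > 0\<close> unfolding abs_continuous_on_def by meson
    \<comment> \<open>The budget \<open>\<delta>\<close> is split in two: \<open>T0\<close> has
      measure below \<open>\<delta>/2\<close>, and the open set \<open>U\<close> exceeds it by less
      than \<open>\<delta>/2\<close>.\<close>
    obtain T0 where T0: "E \<subseteq> T0" "T0 \<in> lmeasurable" "measure lebesgue T0 < \<delta>/2"
      using E \<delta>(1) unfolding negligible_outer by (meson half_gt_zero)
    obtain U where U: "open U" "T0 \<subseteq> U" "U - T0 \<in> lmeasurable" "emeasure lebesgue (U - T0) < ennreal (\<delta>/2)"
      using sets_lebesgue_outer_open[of T0 "\<delta>/2"] T0(2) \<delta>(1) by (auto simp: fmeasurableD)
    have Um: "U \<in> lmeasurable"
      using fmeasurable.Un[OF T0(2) U(3)] U(2) by (simp add: Un_absorb1)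
    have "measure lebesgue (U - T0) < \<delta>/2"
      using U(3,4) \<delta>(1) by (simp add: emeasure_eq_measure2 ennreal_less_iff)
    then have mU: "measure lebesgue U < \<delta>"
      using measurable_measure_Diff[OF Um _ U(2)] T0 by (simp add: fmeasurableD)
    have ex: "\<exists>r>0. \<forall>y\<in>{a..b}. \<bar>y - t\<bar> < r \<longrightarrow> norm (f y - f t) \<le> \<epsilon> * \<bar>y - t\<bar>" if "t \<in> {a..b} - E" for t
      using f'[OF that] \<open>\<epsilon> > 0\<close> unfolding has_vector_derivative_def has_derivative_within_alt by auto
    then obtain r where r: "\<And>t. t \<in> {a..b} - E \<Longrightarrow> r t > 0"
      "\<And>t y. \<lbrakk>t \<in> {a..b} - E; y \<in> {a..b}; \<bar>y - t\<bar> < r t\<rbrakk> \<Longrightarrow> norm (f y - f t) \<le> \<epsilon> * \<bar>y - t\<bar>"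
      by metis
    define \<gamma> where "\<gamma> t = (if t \<in> E then U else if t \<in> {a..b} then ball t (r t) else UNIV)" for t
    have "gauge \<gamma>"
      unfolding gauge_def \<gamma>_def using U T0 r(1) by auto
    then obtain p where p: "p tagged_division_of {a..b}" "\<gamma> fine p"
      by (rule fine_division_exists_real)
    have interval: "\<exists>u v. k = {u..v} \<and> u \<le> t \<and> t \<le> v \<and> a \<le> u \<and> v \<le> b" if "(t, k) \<in> p" for t k
      using tagged_division_ofD(2,3,4)[OF p(1) that] by auto
    define q where "q = {(t, k) \<in> p. t \<in> E}"
    have "q \<subseteq> p" by (auto simp: q_def)
    have finp: "finite p" using p(1) by blast
    have qdiv: "q tagged_division_of \<Union>(snd ` q)"
    proof (intro tagged_partial_division_of_Union_self tagged_partial_division_subset[OF _ \<open>q \<subseteq> p\<close>])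
      show "p tagged_partial_division_of {a..b}" using p(1) by (simp add: tagged_division_of_def)
    qed
    define D where "D = snd ` q"
    have D: "D division_of \<Union>D"
      unfolding D_def using qdiv by (rule division_of_tagged_division)
    have "\<Union>D \<subseteq> {a..b}" unfolding D_def using interval \<open>q \<subseteq> p\<close> by fastforce
    have "\<Union>D \<subseteq> U" unfolding D_def using p(2) unfolding fine_def q_def \<gamma>_def by fastforce
    \<comment> \<open>The total length of \<open>D\<close> is the measure of its union, which the
      gauge forces into \<open>U\<close>. So absolute continuity applies to the intervals tagged in
      \<open>E\<close>.\<close>
    have "(\<Sum>k\<in>D. Sup k - Inf k) = (\<Sum>k\<in>D. measure lebesgue k)"
    proof (rule sum.cong)
      fix k assume "k \<in> D"
      then obtain t where "(t, k) \<in> p" by (auto simp: D_def q_def)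
      then obtain u v where "k = {u..v}" "u \<le> v" using interval by (meson order_trans)
      then show "Sup k - Inf k = measure lebesgue k" by simp
    qed simp
    also have "\<dots> \<le> measure lebesgue U"
      using content_division[OF D] lmeasurable_division[OF D] Um \<open>\<Union>D \<subseteq> U\<close>
      by (simp add: fmeasurableD measure_mono_fmeasurable)
    finally have Dsmall: "(\<Sum>k\<in>D. norm (f (Sup k) - f (Inf k))) < \<epsilon>"
      using mU D \<open>\<Union>D \<subseteq> {a..b}\<close> by (intro \<delta>(2)) auto
    \<comment> \<open>Passing from tagged intervals to the set \<open>D\<close> may identify equal
      intervals, which must be degenerate. The transfer lemma therefore asks for the value 0 on
      degenerate and empty intervals, and \<open>Sup {}\<close> is unspecified.\<close>
    define d where "d k = (if k = {} then 0 else norm (f (Sup k) - f (Inf k)))" for k :: "real set"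
    have "(\<Sum>(t, k)\<in>q. norm (f (Sup k) - f (Inf k))) = (\<Sum>(t, k)\<in>q. d k)"
      by (intro sum.cong refl) (auto simp: d_def dest: tagged_division_ofD(2)[OF qdiv])
    also have "\<dots> = (\<Sum>k\<in>D. d k)"
      unfolding D_def by (rule sum.over_tagged_division_lemma[OF qdiv]) (auto simp: d_def)
    also have "\<dots> = (\<Sum>k\<in>D. norm (f (Sup k) - f (Inf k)))"
      using division_ofD(3)[OF D] by (intro sum.cong refl) (auto simp: d_def)
    finally have sum_q: "(\<Sum>(t, k)\<in>q. norm (f (Sup k) - f (Inf k))) \<le> \<epsilon>"
      using Dsmall by simp
    have "(\<Sum>(t, k)\<in>p - q. norm (f (Sup k) - f (Inf k))) \<le> (\<Sum>(t, k)\<in>p - q. \<epsilon> * (Sup k - Inf k))"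
    proof (rule sum_mono, clarify)
      fix t k assume tk: "(t, k) \<in> p" "(t, k) \<notin> q"
      obtain u v where k: "k = {u..v}" "u \<le> t" "t \<le> v" "a \<le> u" "v \<le> b"
        using interval[OF tk(1)] by blast
      have t: "t \<in> {a..b} - E" using tk k by (auto simp: q_def)
      then have "k \<subseteq> ball t (r t)" using p(2) tk(1) unfolding fine_def \<gamma>_def by fastforce
      then have "u \<in> ball t (r t)" "v \<in> ball t (r t)"
        using k by (meson atLeastAtMost_iff order_refl order_trans subsetD)+
      then have "\<bar>u - t\<bar> < r t" "\<bar>v - t\<bar> < r t" by (auto simp: dist_real_def)
      then have "norm (f u - f t) \<le> \<epsilon> * \<bar>u - t\<bar>" "norm (f v - f t) \<le> \<epsilon> * \<bar>v - t\<bar>"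
        using r(2)[OF t, of u] r(2)[OF t, of v] k by simp_all
      moreover have "norm (f v - f u) \<le> norm (f v - f t) + norm (f u - f t)"
        using norm_triangle_ineq4[of "f v - f t" "f u - f t"] by simp
      \<comment> \<open>As \<open>u \<le> t \<le> v\<close>, the distances of the endpoints from the
        tag add up to \<open>v - u\<close>.\<close>
      ultimately have "norm (f v - f u) \<le> \<epsilon> * (v - u)" using k by (simp add: algebra_simps)
      then show "norm (f (Sup k) - f (Inf k)) \<le> \<epsilon> * (Sup k - Inf k)" using k by simp
    qed
    also have "\<dots> \<le> (\<Sum>(t, k)\<in>p. \<epsilon> * (Sup k - Inf k))"
    proof (rule sum_mono2[OF finp Diff_subset])
      fix z assume "z \<in> p - (p - q)"
      then obtain t k where z: "z = (t, k)" "(t, k) \<in> p" by (cases z) auto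
      then obtain u v where "k = {u..v}" "u \<le> v" using interval by (meson order_trans)
      then show "0 \<le> (case z of (t, k) \<Rightarrow> \<epsilon> * (Sup k - Inf k))" using z \<open>\<epsilon> > 0\<close> by simp
    qed
    also have "\<dots> = \<epsilon> * (\<Sum>(t, k)\<in>p. Sup k - Inf k)"
      by (simp add: sum_distrib_left split_def)
    also have "(\<Sum>(t, k)\<in>p. Sup k - Inf k) = b - a"
      by (rule additive_tagged_division_1[OF \<open>a \<le> b\<close> p(1), of "\<lambda>x. x"])
    finally have sum_rest: "(\<Sum>(t, k)\<in>p - q. norm (f (Sup k) - f (Inf k))) \<le> \<epsilon> * (b - a)" .
    have "norm (f b - f a) \<le> (\<Sum>(t, k)\<in>p. norm (f (Sup k) - f (Inf k)))"
      unfolding additive_tagged_division_1[OF \<open>a \<le> b\<close> p(1), of f, symmetric]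
      by (rule order_trans[OF norm_sum]) (simp add: split_def)
    also have "\<dots> \<le> \<epsilon> * (b - a) + \<epsilon>"
      using sum_q sum_rest sum.subset_diff[OF \<open>q \<subseteq> p\<close> finp, of "\<lambda>(t, k). norm (f (Sup k) - f (Inf k))"]
      by simp
    finally show ?thesis by (simp add: algebra_simps)
  qed
  then have "norm (f b - f a) / (1 + (b - a)) \<le> 0 + \<epsilon>" if "\<epsilon> > 0" for \<epsilon> :: real
    using that \<open>a \<le> b\<close> by (simp add: pos_divide_le_eq)
  then have "norm (f b - f a) / (1 + (b - a)) \<le> 0" by (rule field_le_epsilon)
  then show ?thesis using \<open>a \<le> b\<close> by (simp add: divide_le_0_iff)
qed

lemma loc_abs_continuous_from_imp_continuous_on:
  assumes "loc_abs_continuous_from a f"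
  shows "continuous_on {a..} f"
  unfolding continuous_on_iff
proof (intro ballI allI impI)
  fix t e :: real
  assume t: "t \<in> {a..}" and "e > 0"
  \<comment> \<open>The end \<open>t + 1\<close> leaves room to the right of \<open>t\<close>.
    Continuity then comes from divisions consisting of a single interval.\<close>
  have "abs_continuous_on a (t + 1) f" using assms t by (simp add: loc_abs_continuous_from_def)
  then obtain \<delta> where \<delta>: "\<delta> > 0" "\<And>D. \<lbrakk>D division_of \<Union>D; \<Union>D \<subseteq> {a..t + 1}; (\<Sum>k\<in>D. Sup k - Inf k) < \<delta>\<rbrakk>
      \<Longrightarrow> (\<Sum>k\<in>D. norm (f (Sup k) - f (Inf k))) < e"
    using \<open>e > 0\<close> unfolding abs_continuous_on_def by meson
  have close: "norm (f v - f u) < e" if "a \<le> u" "u \<le> v" "v \<le> t + 1" "v - u < \<delta>" for u v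
  proof -
    have "{{u..v}} division_of \<Union>{{u..v}}" using that division_of_self[of u v] by simp
    then show ?thesis using \<delta>(2)[of "{{u..v}}"] that by simp
  qed
  show "\<exists>d>0. \<forall>s\<in>{a..}. dist s t < d \<longrightarrow> dist (f s) (f t) < e"
  proof (intro exI[of _ "min \<delta> 1"] conjI ballI impI)
    fix s assume s: "s \<in> {a..}" "dist s t < min \<delta> 1"
    then show "dist (f s) (f t) < e"
      using close[of s t] close[of t s] t
      by (cases "s \<le> t") (auto simp: dist_norm norm_minus_commute)
  qed (use \<delta> in auto)
qed

text \<open>The integral \<open>G\<close> of \<open>F\<close> is Lipschitz on compact intervals, so
  \<open>f - G\<close> is absolutely continuous with derivative zero almost everywhere, hence
  constant. Since \<open>F\<close> is continuous, \<open>G\<close> is differentiable at every point,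
  and \<open>f\<close> inherits this.\<close>

lemma abs_continuous_on_AE_derivative_imp_derivative:
  fixes f F :: "real \<Rightarrow> 'a::euclidean_space"
  assumes ac: "loc_abs_continuous_from a f" and F: "continuous_on {a..} F"
    and ae: "AE t in lebesgue. t \<ge> a \<longrightarrow> (f has_vector_derivative F t) (at t within {a..})"
    and "t > a"
  shows "(f has_vector_derivative F t) (at t)"
proof -
  obtain E where E: "negligible E" "\<And>s. \<lbrakk>s \<notin> E; s \<ge> a\<rbrakk> \<Longrightarrow> (f has_vector_derivative F s) (at s within {a..})"
    using ae unfolding eventually_ae_filter_negligible by blast
  \<comment> \<open>This makes \<open>t\<close> an interior point of \<open>{a..b}\<close>, so that
    the derivative within the interval is two-sided.\<close>
  define b where "b = t + 1"
  have "t < b" "a < b" using \<open>t > a\<close> by (auto simp: b_def)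
  have Fb: "continuous_on {a..b} F" using F by (rule continuous_on_subset) auto
  define G where "G s = integral {a..s} F" for s
  have G: "(G has_vector_derivative F s) (at s within {a..b})" if "s \<in> {a..b}" for s
    unfolding G_def using integral_has_vector_derivative[OF Fb that] .
  have "bounded (F ` {a..b})"
    by (intro compact_imp_bounded compact_continuous_image Fb) simp
  then obtain C where C: "\<And>s. s \<in> {a..b} \<Longrightarrow> norm (F s) \<le> C"
    unfolding bounded_iff by blast
  have "C-lipschitz_on {a..b} G"
  proof (rule bounded_derivative_imp_lipschitz)
    show "(G has_derivative (\<lambda>h. h *\<^sub>R F s)) (at s within {a..b})" if "s \<in> {a..b}" for s
      using G[OF that] by (simp add: has_vector_derivative_def)
    show "onorm (\<lambda>h. h *\<^sub>R F s) \<le> C" if "s \<in> {a..b}" for s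
    proof (rule onorm_le)
      show "norm (h *\<^sub>R F s) \<le> C * norm h" for h
        using mult_right_mono[OF C[OF that], of "\<bar>h\<bar>"] by (simp add: mult.commute)
    qed
    show "C \<ge> 0" using order_trans[OF norm_ge_zero C[of a]] \<open>a < b\<close> by simp
  qed simp
  have eq: "f s = G s + f a" if s: "s \<in> {a..b}" for s
  proof (cases "s = a")
    case False
    then have "a < s" using s by simp
    have "f s - G s = f a - G a"
    proof (rule abs_continuous_on_zero_derivative_imp_eq[OF abs_continuous_on_diff])
      show "abs_continuous_on a s f" using ac \<open>a < s\<close> by (simp add: loc_abs_continuous_from_def)
      show "abs_continuous_on a s G"
        using s by (intro lipschitz_on_imp_abs_continuous_on[of C]
            lipschitz_on_subset[OF \<open>C-lipschitz_on {a..b} G\<close>]) auto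
      fix r assume r: "r \<in> {a..s} - E"
      have "(f has_vector_derivative F r) (at r within {a..s})"
        using r by (intro has_vector_derivative_within_subset[OF E(2)]) auto
      moreover have "(G has_vector_derivative F r) (at r within {a..s})"
        using r s by (intro has_vector_derivative_within_subset[OF G]) auto
      ultimately show "((\<lambda>t. f t - G t) has_vector_derivative 0) (at r within {a..s})"
        using has_vector_derivative_diff[of f "F r" _ G "F r"] by simp
    qed (use E(1) s in \<open>simp_all\<close>)
    then show ?thesis by (simp add: G_def diff_eq_eq add.commute)
  qed (simp add: G_def)
  have "((\<lambda>s. G s + f a) has_vector_derivative F t) (at t within {a..b})"
    using has_vector_derivative_add[OF G[of t] has_vector_derivative_const] \<open>t > a\<close> \<open>t < b\<close> by simp
  then have "(f has_vector_derivative F t) (at t within {a..b})"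
    using \<open>t > a\<close> \<open>t < b\<close> by (intro has_vector_derivative_transform[OF _ eq]) auto
  then show ?thesis using at_within_interior[of t "{a..b}"] \<open>t > a\<close> \<open>t < b\<close> by simp
qed

section \<open>Limits at infinity of real functions\<close>

lemma antimono_bounded_below_tendsto_at_top:
  fixes f :: "real \<Rightarrow> real"
  assumes mono: "\<And>s t. \<lbrakk>T \<le> s; s \<le> t\<rbrakk> \<Longrightarrow> f t \<le> f s"
    and lb: "\<And>t. t \<ge> T \<Longrightarrow> B \<le> f t"
  shows "\<exists>l. (f \<longlongrightarrow> l) at_top"
proof
  have bdd: "bdd_below (f ` {T..})" using lb by (auto intro!: bdd_belowI)
  show "(f \<longlongrightarrow> Inf (f ` {T..})) at_top"
  proof (rule decreasing_tendsto)
    show "\<forall>\<^sub>F t in at_top. Inf (f ` {T..}) \<le> f t"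
      using eventually_ge_at_top[of T] by eventually_elim (use bdd in \<open>auto intro: cInf_lower\<close>)
    fix y assume "Inf (f ` {T..}) < y"
    then obtain s where "s \<ge> T" "f s < y" using cInf_less_iff[OF _ bdd] by auto
    show "\<forall>\<^sub>F t in at_top. f t < y"
      using eventually_ge_at_top[of s]
      by eventually_elim (use mono \<open>s \<ge> T\<close> \<open>f s < y\<close> in \<open>auto intro: le_less_trans\<close>)
  qed
qed

text \<open>Write \<open>h\<close> as the quotient of \<open>h t * t powr a\<close> by
  \<open>t powr a\<close>. The quotient of the derivatives is
  \<open>(a * h t + t * h' t) / a\<close>, so l'Hospital's rule applies; the denominator tends to
  infinity because \<open>a > 0\<close>.\<close>

lemma tendsto_at_top_of_euler_combination:
  fixes h h' :: "real \<Rightarrow> real"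
  assumes "a > 0" and h: "\<forall>\<^sub>F t in at_top. (h has_real_derivative h' t) (at t)"
    and lim: "((\<lambda>t. a * h t + t * h' t) \<longlongrightarrow> l) at_top"
  shows "(h \<longlongrightarrow> l / a) at_top"
proof -
  have "((\<lambda>t. (h t * t powr a) / t powr a) \<longlongrightarrow> l / a) at_top"
  proof (rule lhospital_at_top_at_top)
    have "filterlim (\<lambda>t. exp (a * ln t)) at_top at_top"
      using \<open>a > 0\<close>
      by (intro filterlim_compose[OF exp_at_top] filterlim_tendsto_pos_mult_at_top[OF tendsto_const] ln_at_top)
    then show "filterlim (\<lambda>t. t powr a) at_top at_top"
      by (rule filterlim_mono_eventually[OF _ order_refl order_refl])
         (use eventually_gt_at_top[of 0] in eventually_elim, simp add: powr_def)
    show "\<forall>\<^sub>F t in at_top. a * t powr (a - 1) \<noteq> 0"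
      using eventually_gt_at_top[of 0] by eventually_elim (use \<open>a > 0\<close> in auto)
    show "\<forall>\<^sub>F t in at_top. ((\<lambda>t. t powr a) has_real_derivative a * t powr (a - 1)) (at t)"
      using eventually_gt_at_top[of 0] by eventually_elim (auto intro!: derivative_eq_intros)
    show "\<forall>\<^sub>F t in at_top. ((\<lambda>t. h t * t powr a) has_real_derivative
        h' t * t powr a + h t * (a * t powr (a - 1))) (at t)"
      using eventually_gt_at_top[of 0] h
      by eventually_elim (auto intro!: derivative_eq_intros)
    have "\<forall>\<^sub>F t in at_top. (a * h t + t * h' t) / a =
        (h' t * t powr a + h t * (a * t powr (a - 1))) / (a * t powr (a - 1))"
      using eventually_gt_at_top[of 0]
    proof eventually_elim
      case (elim t)
      have "t powr a = t * t powr (a - 1)" using elim by (simp add: powr_mult_base)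
      then show ?case using elim \<open>a > 0\<close> by (simp add: field_simps)
    qed
    moreover have "((\<lambda>t. (a * h t + t * h' t) / a) \<longlongrightarrow> l / a) at_top"
      using lim \<open>a > 0\<close> by (intro tendsto_intros) auto
    ultimately show "((\<lambda>t. (h' t * t powr a + h t * (a * t powr (a - 1))) / (a * t powr (a - 1))) \<longlongrightarrow> l / a) at_top"
      by (rule Lim_transform_eventually[rotated])
  qed
  moreover have "\<forall>\<^sub>F t in at_top. (h t * t powr a) / t powr a = h t"
    using eventually_gt_at_top[of 0] by eventually_elim auto
  ultimately show ?thesis by (rule Lim_transform_eventually)
qed

section \<open>The gradient inequality and derivatives of squared norms\<close>

text \<open>Restricting \<open>g\<close> to the line through \<open>y\<close> and \<open>p\<close>
  reduces this to the tangent inequality for a convex function of one real variable.\<close>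

lemma convex_on_GDERIV_above_tangent:
  fixes g :: "'a::real_inner \<Rightarrow> real"
  assumes convex: "convex_on UNIV g" and g': "GDERIV g y :> d"
  shows "g p - g y \<ge> d \<bullet> (p - y)"
proof -
  define \<phi> where "\<phi> s = g (y + s *\<^sub>R (p - y))" for s :: real
  have "convex_on UNIV \<phi>"
  proof (rule convex_onI)
    fix t r s :: real assume "0 < t" "t < 1"
    have "y + ((1 - t) * r + t * s) *\<^sub>R (p - y)
        = (1 - t) *\<^sub>R (y + r *\<^sub>R (p - y)) + t *\<^sub>R (y + s *\<^sub>R (p - y))"
      by (simp add: algebra_simps)
    then show "\<phi> ((1 - t) *\<^sub>R r + t *\<^sub>R s) \<le> (1 - t) * \<phi> r + t * \<phi> s"
      using convex_onD[OF convex, of t] \<open>0 < t\<close> \<open>t < 1\<close> by (simp add: \<phi>_def)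
  qed simp
  moreover have "(\<phi> has_field_derivative (p - y) \<bullet> d) (at 0)"
  proof -
    have "((\<lambda>s. y + s *\<^sub>R (p - y)) has_derivative (\<lambda>s. s *\<^sub>R (p - y))) (at 0)"
      by (auto intro!: derivative_eq_intros)
    moreover have "(g has_derivative (\<lambda>h. h \<bullet> d)) (at (y + 0 *\<^sub>R (p - y)))"
      using g' by (simp add: gderiv_def)
    ultimately have "(\<phi> has_derivative (\<lambda>s. (s *\<^sub>R (p - y)) \<bullet> d)) (at 0)"
      unfolding \<phi>_def by (rule has_derivative_compose)
    then show ?thesis by (simp add: has_field_derivative_def mult.commute[of _ "(p - y) \<bullet> d"])
  qed
  ultimately have "\<phi> 1 - \<phi> 0 \<ge> (p - y) \<bullet> d * (1 - 0)"
    by (intro convex_on_imp_above_tangent[where A = UNIV]) auto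
  then show ?thesis by (simp add: \<phi>_def inner_commute)
qed

lemma has_real_derivative_half_inner_self:
  fixes u :: "real \<Rightarrow> 'a::real_inner"
  assumes "(u has_vector_derivative d) (at t)"
  shows "((\<lambda>t. (u t \<bullet> u t) / 2) has_real_derivative d \<bullet> u t) (at t)"
proof -
  have u: "(u has_derivative (\<lambda>h. h *\<^sub>R d)) (at t)"
    using assms by (simp add: has_vector_derivative_def)
  have "((\<lambda>t. u t \<bullet> u t) has_real_derivative 2 * (d \<bullet> u t)) (at t)"
    unfolding has_field_derivative_def
    by (rule has_derivative_eq_rhs[OF has_derivative_inner[OF u u]])
       (simp add: fun_eq_iff inner_commute)
  from DERIV_cdivide[OF this, of 2] show ?thesis by simp
qed

section \<open>Energies of the inertial system\<close>

text \<open>The system in classical form, with two-sided derivatives at every \<open>t > t0\<close>,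
  so that energies can be differentiated pointwise and their monotonicity read off from the sign of
  the derivative.\<close>

locale inertial_system =
  fixes g :: "'a::euclidean_space \<Rightarrow> real" and grad :: "'a \<Rightarrow> 'a"
    and x v :: "real \<Rightarrow> 'a" and t0 \<alpha> \<beta> :: real
  assumes convex: "convex_on UNIV g"
    and gderiv: "\<And>z. GDERIV g z :> grad z"
    and t0: "t0 > 0" and \<alpha>: "\<alpha> > 3" and \<beta>: "\<beta> \<ge> 0"
    and x': "\<And>t. t > t0 \<Longrightarrow> (x has_vector_derivative v t) (at t)"
    and v': "\<And>t. t > t0 \<Longrightarrow>
      (v has_vector_derivative - (\<alpha> / t) *\<^sub>R v t - grad (x t + (\<beta> / t) *\<^sub>R v t)) (at t)"
begin

definition y :: "real \<Rightarrow> 'a" where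
  "y t = x t + (\<beta> / t) *\<^sub>R v t"

text \<open>The weight \<open>b * (\<alpha> - 1 - b)\<close> of the last summand is chosen so that
  the terms in \<open>v t \<bullet> (x t - p)\<close> cancel in the derivative.\<close>

definition energy :: "real \<Rightarrow> 'a \<Rightarrow> real \<Rightarrow> real" where
  "energy b p t = t\<^sup>2 * (g (y t) - g p)
     + ((b *\<^sub>R (x t - p) + t *\<^sub>R v t) \<bullet> (b *\<^sub>R (x t - p) + t *\<^sub>R v t)) / 2
     + b * (\<alpha> - 1 - b) * (((x t - p) \<bullet> (x t - p)) / 2)"

lemma has_real_derivative_energy:
  assumes "t > t0"
  shows "(energy b p has_real_derivative
     2 * t * (g (y t) - g p) - \<beta> * (\<alpha> + 1) * (grad (y t) \<bullet> v t)
       - \<beta> * t * (grad (y t) \<bullet> grad (y t)) - b * t * (grad (y t) \<bullet> (x t - p))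
       - (\<alpha> - 1 - b) * t * (v t \<bullet> v t)) (at t)"
proof -
  have t: "t > 0" using assms t0 by simp
  define G where "G = grad (y t)"
  define acc where "acc = - (\<alpha> / t) *\<^sub>R v t - G"
  have dx: "(x has_vector_derivative v t) (at t)" using x' assms .
  have dv: "(v has_vector_derivative acc) (at t)"
    using v'[OF assms] by (simp add: acc_def G_def y_def)
  have "((\<lambda>t. \<beta> / t) has_real_derivative - (\<beta> / t\<^sup>2)) (at t)"
    using t by (auto intro!: derivative_eq_intros simp: power2_eq_square)
  from has_vector_derivative_add[OF dx has_vector_derivative_scaleR[OF this dv]]
  have "(y has_vector_derivative (v t + (\<beta> / t) *\<^sub>R acc - (\<beta> / t\<^sup>2) *\<^sub>R v t)) (at t)"
    unfolding y_def by (simp add: algebra_simps)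
  then have dy: "(y has_derivative (\<lambda>h. h *\<^sub>R (v t + (\<beta> / t) *\<^sub>R acc - (\<beta> / t\<^sup>2) *\<^sub>R v t))) (at t)"
    by (simp add: has_vector_derivative_def)
  have "(g has_derivative (\<lambda>h. h \<bullet> G)) (at (y t))"
    using gderiv by (simp add: gderiv_def G_def)
  from has_derivative_compose[OF dy this]
  have dg: "((\<lambda>t. g (y t)) has_real_derivative
      (v t + (\<beta> / t) *\<^sub>R acc - (\<beta> / t\<^sup>2) *\<^sub>R v t) \<bullet> G) (at t)"
    by (simp add: has_field_derivative_def mult.commute[of _ "_ \<bullet> G"])
  have dxp: "((\<lambda>t. x t - p) has_vector_derivative v t) (at t)"
    using has_vector_derivative_diff[OF dx has_vector_derivative_const] by simp
  let ?w = "b *\<^sub>R (x t - p) + t *\<^sub>R v t"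
  have dw: "((\<lambda>t. b *\<^sub>R (x t - p) + t *\<^sub>R v t) has_vector_derivative
      b *\<^sub>R v t + v t + t *\<^sub>R acc) (at t)"
    by (rule has_vector_derivative_eq_rhs[OF has_vector_derivative_add
        [OF has_vector_derivative_scaleR[OF DERIV_const dxp] has_vector_derivative_scaleR[OF DERIV_ident dv]]])
       simp
  have E: "(energy b p has_real_derivative 2 * t * (g (y t) - g p)
      + t\<^sup>2 * ((v t + (\<beta> / t) *\<^sub>R acc - (\<beta> / t\<^sup>2) *\<^sub>R v t) \<bullet> G)
      + (b *\<^sub>R v t + v t + t *\<^sub>R acc) \<bullet> ?w + b * (\<alpha> - 1 - b) * (v t \<bullet> (x t - p))) (at t)"
    unfolding energy_def
    by (rule derivative_eq_intros refl dg has_real_derivative_half_inner_self[OF dw]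
        has_real_derivative_half_inner_self[OF dxp])+ simp
  \<comment> \<open>In the coefficient \<open>\<alpha> + 1\<close> of the cross term,
    \<open>\<alpha>\<close> comes from the damping in \<open>acc\<close> and 1 from differentiating
    \<open>\<beta> / t\<close>. The term \<open>t\<^sup>2 * (G \<bullet> v t)\<close> cancels
    against the derivative of the mixed square below.\<close>
  have "t\<^sup>2 * ((v t + (\<beta> / t) *\<^sub>R acc - (\<beta> / t\<^sup>2) *\<^sub>R v t) \<bullet> G)
      = t\<^sup>2 * (G \<bullet> v t) - \<beta> * (\<alpha> + 1) * (G \<bullet> v t) - \<beta> * t * (G \<bullet> G)"
    using t by (simp add: acc_def inner_simps inner_commute field_simps power2_eq_square)
  moreover have "(b *\<^sub>R v t + v t + t *\<^sub>R acc) = (b + 1 - \<alpha>) *\<^sub>R v t - t *\<^sub>R G"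
    using t by (simp add: acc_def algebra_simps)
  then have "(b *\<^sub>R v t + v t + t *\<^sub>R acc) \<bullet> ?w + b * (\<alpha> - 1 - b) * (v t \<bullet> (x t - p))
      = - (\<alpha> - 1 - b) * t * (v t \<bullet> v t) - b * t * (G \<bullet> (x t - p)) - t\<^sup>2 * (G \<bullet> v t)"
    by (simp only: inner_simps inner_commute[of "v t" G] inner_commute[of "v t" "x t"]
        inner_commute[of "v t" p]) (simp add: inner_commute algebra_simps power2_eq_square)
  ultimately show ?thesis
    by (intro DERIV_cong[OF E]) (simp add: G_def[symmetric] left_diff_distrib)
qed

text \<open>As \<open>b \<ge> 2\<close>, the term \<open>2 * t * (g (y t) - g p)\<close> is at most
  \<open>b * t * (g (y t) - g p)\<close>, which the gradient inequality at \<open>y t\<close> bounds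
  by the \<open>x t - p\<close> term plus a cross term. What remains is a quadratic form in
  \<open>grad (y t)\<close> and \<open>v t\<close>, nonpositive for large \<open>t\<close> because
  \<open>b < \<alpha> - 1\<close>.\<close>

lemma energy_eventually_nonincreasing:
  assumes b: "2 \<le> b" "b < \<alpha> - 1" and p: "p \<in> argmin_set g"
  shows "\<exists>T>t0. \<forall>s t. T \<le> s \<longrightarrow> s \<le> t \<longrightarrow> energy b p t \<le> energy b p s"
proof -
  \<comment> \<open>The cross term has coefficient \<open>- \<beta> * (\<alpha> + 1)\<close> in the
    derivative, and the gradient inequality adds \<open>b * \<beta>\<close>: the sum is
    \<open>- \<beta> * k\<close>. The damping of \<open>v t\<close> has coefficient
    \<open>- c * t\<close>.\<close>
  define k where "k = \<alpha> + 1 - b"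
  define c where "c = \<alpha> - 1 - b"
  have c: "c > 0" using b by (simp add: c_def)
  \<comment> \<open>The third entry gives \<open>\<beta> * k\<^sup>2 / 4 \<le> c * t\<close>, and
    \<open>t \<ge> 1\<close> then yields the bound by \<open>c * t * t\<close> needed to absorb the
    square's remainder.\<close>
  define T where "T = Max {t0 + 1, 1, \<beta> * k\<^sup>2 / (4 * c)}"
  have T: "T > t0" "T \<ge> 1" "T \<ge> \<beta> * k\<^sup>2 / (4 * c)" by (auto simp: T_def)
  have deriv: "\<exists>D. (energy b p has_real_derivative D) (at t) \<and> D \<le> 0" if "t \<ge> T" for t
  proof -
    have t: "t \<ge> 1" "t > 0" using that T by auto
    let ?G = "grad (y t)"
    have "g p \<le> g (y t)" using p by (auto simp: argmin_set_def is_arg_min_linorder)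
    then have gap: "b * t * (g (y t) - g p) \<ge> 2 * t * (g (y t) - g p)"
      using b t by (intro mult_right_mono) auto
    have "g p - g (y t) \<ge> ?G \<bullet> (p - y t)"
      by (intro convex_on_GDERIV_above_tangent convex gderiv)
    then have "g (y t) - g p \<le> ?G \<bullet> (x t - p) + (\<beta> / t) * (?G \<bullet> v t)"
      by (simp add: y_def inner_simps)
    then have "b * t * (g (y t) - g p) \<le> b * t * (?G \<bullet> (x t - p) + (\<beta> / t) * (?G \<bullet> v t))"
      using b t by (intro mult_left_mono) auto
    also have "\<dots> = b * t * (?G \<bullet> (x t - p)) + b * \<beta> * (?G \<bullet> v t)"
      using t by (simp add: field_simps)
    finally have tangent: "b * t * (g (y t) - g p) \<le> b * t * (?G \<bullet> (x t - p)) + b * \<beta> * (?G \<bullet> v t)" .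
    \<comment> \<open>Complete the square to absorb the cross term \<open>\<beta> * k * (?G \<bullet> v t)\<close>.\<close>
    have "0 \<le> (t *\<^sub>R ?G + (k / 2) *\<^sub>R v t) \<bullet> (t *\<^sub>R ?G + (k / 2) *\<^sub>R v t) * (\<beta> / t)"
      using t \<beta> by simp
    also have "\<dots> = \<beta> * t * (?G \<bullet> ?G) + \<beta> * k * (?G \<bullet> v t) + \<beta> * k\<^sup>2 / (4 * t) * (v t \<bullet> v t)"
      using t by (simp add: inner_simps inner_commute field_simps power2_eq_square)
    also have "\<beta> * k\<^sup>2 / (4 * t) * (v t \<bullet> v t) \<le> c * t * (v t \<bullet> v t)"
    proof (rule mult_right_mono)
      have "\<beta> * k\<^sup>2 / 4 \<le> c * t"
        using order_trans[OF T(3) that] c by (simp add: field_simps)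
      also have "\<dots> \<le> c * t * t" using t c by simp
      finally show "\<beta> * k\<^sup>2 / (4 * t) \<le> c * t" using t by (simp add: field_simps)
    qed simp
    finally have "2 * t * (g (y t) - g p) - \<beta> * (\<alpha> + 1) * (?G \<bullet> v t)
       - \<beta> * t * (?G \<bullet> ?G) - b * t * (?G \<bullet> (x t - p)) - (\<alpha> - 1 - b) * t * (v t \<bullet> v t) \<le> 0"
      using gap tangent by (simp add: k_def c_def algebra_simps)
    moreover have "t > t0" using T that by simp
    ultimately show ?thesis using has_real_derivative_energy by blast
  qed
  have "energy b p t \<le> energy b p s" if "T \<le> s" "s \<le> t" for s t
    by (rule DERIV_nonpos_imp_nonincreasing) (use deriv that in auto)
  then show ?thesis using T(1) by blast
qed

lemma energy_summands_nonneg: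
  assumes "0 \<le> b" "b \<le> \<alpha> - 1" and p: "p \<in> argmin_set g"
  shows "0 \<le> t\<^sup>2 * (g (y t) - g p)"
    and "0 \<le> b * (\<alpha> - 1 - b) * (((x t - p) \<bullet> (x t - p)) / 2)"
  using assms by (auto simp: argmin_set_def is_arg_min_linorder)

lemma energy_tendsto:
  assumes b: "2 \<le> b" "b < \<alpha> - 1" and p: "p \<in> argmin_set g"
  shows "\<exists>l. (energy b p \<longlongrightarrow> l) at_top"
proof -
  obtain T where "\<And>s t. \<lbrakk>T \<le> s; s \<le> t\<rbrakk> \<Longrightarrow> energy b p t \<le> energy b p s"
    using energy_eventually_nonincreasing[OF assms] by blast
  moreover have "0 \<le> energy b p t" for t
    using energy_summands_nonneg[of b p t] b p by (simp add: energy_def)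
  ultimately show ?thesis by (intro antimono_bounded_below_tendsto_at_top)
qed

section \<open>Convergence of distances, values and the trajectory\<close>

text \<open>In the difference of two energies the value gap and the \<open>v t \<bullet> v t\<close>
  terms cancel, and the \<open>x t - p\<close> terms become linear in \<open>b\<close>. This leaves
  a convergent combination of \<open>h\<close> and \<open>t * h'\<close>, from which the limit of
  \<open>h\<close> follows.\<close>

lemma norm_diff_argmin_tendsto:
  assumes p: "p \<in> argmin_set g"
  shows "\<exists>l. ((\<lambda>t. norm (x t - p)) \<longlongrightarrow> l) at_top"
proof -
  \<comment> \<open>The midpoint of 2 and \<open>\<alpha> - 1\<close>: admissible and different from
    2 since \<open>\<alpha> > 3\<close>.\<close>
  define b where "b = (\<alpha> + 1) / 2"
  define h where "h t = ((x t - p) \<bullet> (x t - p)) / 2" for t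
  obtain l1 l2 where l: "(energy b p \<longlongrightarrow> l1) at_top" "(energy 2 p \<longlongrightarrow> l2) at_top"
    using energy_tendsto[OF _ _ p, of b] energy_tendsto[OF _ _ p, of 2] \<alpha> by (auto simp: b_def)
  have b2: "b - 2 \<noteq> 0" using \<alpha> by (simp add: b_def)
  have "(energy b p t - energy 2 p t) / (b - 2) = (\<alpha> - 1) * h t + t * ((x t - p) \<bullet> v t)" for t
  proof -
    have "energy b p t - energy 2 p t = (b - 2) * ((\<alpha> - 1) * h t + t * ((x t - p) \<bullet> v t))"
      unfolding energy_def h_def inner_add_left inner_add_right inner_scaleR_left inner_scaleR_right
        inner_commute[of "v t" "x t - p"]
      by (simp add: field_simps)
    then show ?thesis using b2 by simp
  qed
  then have "((\<lambda>t. (\<alpha> - 1) * h t + t * ((x t - p) \<bullet> v t)) \<longlongrightarrow> (l1 - l2) / (b - 2)) at_top"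
    using tendsto_divide[OF tendsto_diff[OF l] tendsto_const b2] by simp
  moreover have "\<forall>\<^sub>F t in at_top. (h has_real_derivative (x t - p) \<bullet> v t) (at t)"
    using eventually_gt_at_top[of t0]
  proof eventually_elim
    case (elim t)
    have "((\<lambda>t. x t - p) has_vector_derivative v t) (at t)"
      using has_vector_derivative_diff[OF x'[OF elim] has_vector_derivative_const] by simp
    from has_real_derivative_half_inner_self[OF this] show ?case
      unfolding h_def by (simp add: inner_commute)
  qed
  ultimately obtain m where "(h \<longlongrightarrow> m) at_top"
    using tendsto_at_top_of_euler_combination[of "\<alpha> - 1" h] \<alpha> by fastforce
  then have "((\<lambda>t. sqrt (2 * h t)) \<longlongrightarrow> sqrt (2 * m)) at_top" by (intro tendsto_intros)
  then show ?thesis by (auto simp: h_def norm_eq_sqrt_inner)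
qed

text \<open>Boundedness of the energy with \<open>b = 2\<close> makes the value gap of order
  \<open>1 / t\<^sup>2\<close>. It also bounds \<open>w\<close>, hence
  \<open>t *\<^sub>R v t\<close> because \<open>x t - p\<close> is bounded, so
  \<open>y t - x t\<close> is of the same order.\<close>

lemma y_diff_x_tendsto_and_value_tendsto:
  assumes p: "p \<in> argmin_set g"
  shows "((\<lambda>t. y t - x t) \<longlongrightarrow> 0) at_top" and "((\<lambda>t. g (y t)) \<longlongrightarrow> g p) at_top"
proof -
  define w where "w t = 2 *\<^sub>R (x t - p) + t *\<^sub>R v t" for t
  obtain l where "(energy 2 p \<longlongrightarrow> l) at_top"
    using energy_tendsto[OF _ _ p, of 2] \<alpha> by auto
  then have "\<forall>\<^sub>F t in at_top. energy 2 p t < l + 1"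
    by (rule order_tendstoD) simp
  \<comment> \<open>All three summands of the energy are nonnegative, so each lies below the bound
    on the sum.\<close>
  then have *: "\<forall>\<^sub>F t in at_top. t\<^sup>2 * (g (y t) - g p) \<le> l + 1 \<and> w t \<bullet> w t \<le> 2 * (l + 1)"
  proof eventually_elim
    case (elim t)
    then show ?case
      using energy_summands_nonneg(1)[of 2 p t] energy_summands_nonneg(2)[of 2 p t] \<alpha> p inner_ge_zero[of "w t"]
      unfolding energy_def w_def[symmetric] by argo
  qed
  have inv: "((\<lambda>t::real. C / t\<^sup>2) \<longlongrightarrow> 0) at_top" for C :: real
    by (intro tendsto_divide_0[OF tendsto_const] filterlim_at_top_imp_at_infinity filterlim_pow_at_top filterlim_ident) simp
  have "((\<lambda>t. g (y t) - g p) \<longlongrightarrow> 0) at_top"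
  proof (rule tendsto_sandwich[OF _ _ tendsto_const inv])
    show "\<forall>\<^sub>F t in at_top. 0 \<le> g (y t) - g p"
      using p by (auto simp: argmin_set_def is_arg_min_linorder)
    show "\<forall>\<^sub>F t in at_top. g (y t) - g p \<le> (l + 1) / t\<^sup>2"
      using * eventually_gt_at_top[of 0]
      by eventually_elim (auto simp: pos_le_divide_eq mult.commute)
  qed
  then show "((\<lambda>t. g (y t)) \<longlongrightarrow> g p) at_top" by (rule LIM_zero_cancel)
  obtain m where "((\<lambda>t. norm (x t - p)) \<longlongrightarrow> m) at_top" using norm_diff_argmin_tendsto[OF p] by blast
  then have "\<forall>\<^sub>F t in at_top. norm (x t - p) < m + 1" by (rule order_tendstoD) simp
  with * have "\<forall>\<^sub>F t in at_top. norm (y t - x t) \<le> \<beta> * (sqrt (2 * (l + 1)) + 2 * (m + 1)) / t\<^sup>2"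
    using eventually_gt_at_top[of 0]
  proof eventually_elim
    case (elim t)
    have "norm (w t) \<le> sqrt (2 * (l + 1))" using elim by (simp add: norm_eq_sqrt_inner)
    moreover have "t *\<^sub>R v t = w t - 2 *\<^sub>R (x t - p)" by (simp add: w_def)
    then have "t * norm (v t) \<le> norm (w t) + 2 * norm (x t - p)"
      using norm_triangle_ineq4[of "w t" "2 *\<^sub>R (x t - p)"] elim by (metis abs_of_pos norm_scaleR abs_numeral)
    moreover have "2 * norm (x t - p) \<le> 2 * (m + 1)" using elim by simp
    ultimately have "t * norm (v t) \<le> sqrt (2 * (l + 1)) + 2 * (m + 1)"
      by (meson add_mono order_trans)
    then have "\<beta> * (t * norm (v t)) / t\<^sup>2 \<le> \<beta> * (sqrt (2 * (l + 1)) + 2 * (m + 1)) / t\<^sup>2"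
      using \<beta> by (intro divide_right_mono mult_left_mono) auto
    moreover have "norm (y t - x t) = \<beta> * (t * norm (v t)) / t\<^sup>2"
      using elim \<beta> by (simp add: y_def power2_eq_square)
    ultimately show ?case by simp
  qed
  then show "((\<lambda>t. y t - x t) \<longlongrightarrow> 0) at_top" by (rule Lim_null_comparison[OF _ inv])
qed

text \<open>Opial's argument: a cluster point \<open>p\<close> of the bounded trajectory is a
  minimiser, so the distance to \<open>p\<close> has a limit, and that limit is 0 along the
  subsequence.\<close>

theorem tendsto_argmin:
  assumes "argmin_set g \<noteq> {}"
  shows "\<exists>p \<in> argmin_set g. (x \<longlongrightarrow> p) at_top"
proof -
  obtain z where z: "z \<in> argmin_set g" using assms by blast
  obtain m where m: "((\<lambda>t. norm (x t - z)) \<longlongrightarrow> m) at_top" using norm_diff_argmin_tendsto[OF z] by blast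
  then have "\<forall>\<^sub>F t in at_top. norm (x t - z) < m + 1" by (rule order_tendstoD) simp
  then obtain T where T: "\<And>t. t \<ge> T \<Longrightarrow> norm (x t - z) < m + 1" unfolding eventually_at_top_linorder by blast
  \<comment> \<open>Sampling at the times \<open>T + real n\<close> gives a sequence in a compact
    ball.\<close>
  have "\<forall>n. x (T + real n) \<in> cball z (m + 1)"
    using T by (auto simp: dist_norm norm_minus_commute less_imp_le)
  then obtain p r where r: "strict_mono (r :: nat \<Rightarrow> nat)" "((\<lambda>n. x (T + real n)) \<circ> r) \<longlonglongrightarrow> p"
    using seq_compactE[of "cball z (m + 1)"] compact_imp_seq_compact compact_cball by metis
  define s where "s n = T + real (r n)" for n
  have s: "filterlim s at_top sequentially"
    unfolding s_def
    by (intro filterlim_tendsto_add_at_top[OF tendsto_const] filterlim_compose[OF filterlim_real_sequentially]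
        filterlim_subseq r(1))
  have xs: "(\<lambda>n. x (s n)) \<longlonglongrightarrow> p" using r(2) by (simp add: s_def o_def)
  \<comment> \<open>Values are controlled along \<open>y\<close> only, so the cluster point of
    \<open>x\<close> is first transferred to \<open>y\<close>.\<close>
  have "(\<lambda>n. y (s n) - x (s n)) \<longlonglongrightarrow> 0"
    using filterlim_compose[OF y_diff_x_tendsto_and_value_tendsto(1)[OF z] s] .
  from tendsto_add[OF this xs] have "(\<lambda>n. y (s n)) \<longlonglongrightarrow> p" by simp
  moreover have "isCont g p" using gderiv has_derivative_continuous unfolding gderiv_def by blast
  ultimately have "(\<lambda>n. g (y (s n))) \<longlonglongrightarrow> g p" by (rule isCont_tendsto_compose[rotated])
  moreover have "(\<lambda>n. g (y (s n))) \<longlonglongrightarrow> g z"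
    using filterlim_compose[OF y_diff_x_tendsto_and_value_tendsto(2)[OF z] s] .
  ultimately have "g p = g z" by (rule LIMSEQ_unique)
  then have p: "p \<in> argmin_set g" using z by (auto simp: argmin_set_def is_arg_min_linorder)
  obtain l where l: "((\<lambda>t. norm (x t - p)) \<longlongrightarrow> l) at_top" using norm_diff_argmin_tendsto[OF p] by blast
  have "(\<lambda>n. norm (x (s n) - p)) \<longlonglongrightarrow> l" using filterlim_compose[OF l s] .
  moreover have "(\<lambda>n. norm (x (s n) - p)) \<longlonglongrightarrow> 0"
    using xs by (simp add: LIM_zero tendsto_norm_zero)
  ultimately have "l = 0" by (rule LIMSEQ_unique)
  then have "(x \<longlongrightarrow> p) at_top" using l by (simp add: tendsto_norm_zero_iff LIM_zero_iff)
  with p show ?thesis by blast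
qed

end

section \<open>From the strong solution to the classical system\<close>

theorem mainTheorem7:
  fixes g :: "real ^ 'm \<Rightarrow> real"
    and grad :: "real ^ 'm \<Rightarrow> real ^ 'm"
    and x :: "real \<Rightarrow> real ^ 'm"
    and u0 v0 :: "real ^ 'm"
    and L t0 \<alpha> \<beta> :: real
  assumes "convex_on UNIV g"
    and "\<And>z. GDERIV g z :> grad z"
    and "L-lipschitz_on UNIV grad"
    and "argmin_set g \<noteq> {}"
    and "t0 > 0"
    and "\<alpha> > 3"
    and "\<beta> \<ge> 0"
    and "strong_global_solution grad \<alpha> \<beta> t0 u0 v0 x"
  shows "\<exists>p \<in> argmin_set g. (x \<longlongrightarrow> p) at_top"
proof -
  obtain v where x': "\<And>t. t \<ge> t0 \<Longrightarrow> (x has_vector_derivative v t) (at t within {t0..})"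
    and ac: "loc_abs_continuous_from t0 v"
    and ae: "AE t in lebesgue. t \<ge> t0 \<longrightarrow> (\<exists>a. (v has_vector_derivative a) (at t within {t0..})
                 \<and> a + (\<alpha> / t) *\<^sub>R v t + grad (x t + (\<beta> / t) *\<^sub>R v t) = 0)"
    using assms(8) unfolding strong_global_solution_def by blast
  \<comment> \<open>The equation solved for the acceleration. It is continuous on
    \<open>{t0..}\<close> because \<open>v\<close> is, because the Lipschitz bound makes
    \<open>grad\<close> continuous, and because \<open>t0 > 0\<close> keeps the quotients by
    \<open>t\<close> regular.\<close>
  define F where "F t = - (\<alpha> / t) *\<^sub>R v t - grad (x t + (\<beta> / t) *\<^sub>R v t)" for t
  have v: "continuous_on {t0..} v" using ac by (rule loc_abs_continuous_from_imp_continuous_on)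
  have x: "continuous_on {t0..} x"
    unfolding continuous_on_eq_continuous_within using x' has_vector_derivative_continuous by blast
  have y: "continuous_on {t0..} (\<lambda>t. x t + (\<beta> / t) *\<^sub>R v t)"
    using \<open>t0 > 0\<close> by (intro continuous_intros x v) auto
  have "continuous_on {t0..} (\<lambda>t. grad (x t + (\<beta> / t) *\<^sub>R v t))"
    by (rule continuous_on_compose2[OF lipschitz_on_continuous_on[OF assms(3)] y]) simp
  then have F: "continuous_on {t0..} F"
    unfolding F_def using \<open>t0 > 0\<close> by (intro continuous_intros v) auto
  have "AE t in lebesgue. t \<ge> t0 \<longrightarrow> (v has_vector_derivative F t) (at t within {t0..})"
    using ae
  proof (rule AE_mp, intro AE_I2 impI)
    fix t assume "t \<ge> t0 \<longrightarrow> (\<exists>a. (v has_vector_derivative a) (at t within {t0..})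
                 \<and> a + (\<alpha> / t) *\<^sub>R v t + grad (x t + (\<beta> / t) *\<^sub>R v t) = 0)" "t \<ge> t0"
    then obtain a where a: "(v has_vector_derivative a) (at t within {t0..})"
      "a + (\<alpha> / t) *\<^sub>R v t + grad (x t + (\<beta> / t) *\<^sub>R v t) = 0" by blast
    then have "a = F t" unfolding F_def scaleR_minus_left by (simp add: eq_neg_iff_add_eq_0 add_ac eq_diff_eq)
    with a show "(v has_vector_derivative F t) (at t within {t0..})" by simp
  qed
  note v' = abs_continuous_on_AE_derivative_imp_derivative[OF ac F this]
  interpret inertial_system g grad x v t0 \<alpha> \<beta>
  proof
    fix t assume "t > t0"
    then show "(x has_vector_derivative v t) (at t)"
      using x'[of t] at_within_interior[of t "{t0..}"] by simp
    show "(v has_vector_derivative - (\<alpha> / t) *\<^sub>R v t - grad (x t + (\<beta> / t) *\<^sub>R v t)) (at t)"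
      using v'[OF \<open>t > t0\<close>] by (simp add: F_def)
  qed (use assms in auto)
  show ?thesis using assms(4) by (rule tendsto_argmin)
qed

end
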